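(* Let $X$ be an object in a category $\mathcal{C}$ with (finite) products, where every product projection in $\mathcal{C}$ is a regular epimorphism. Then $X$ has the (finite) strict refinement property if and only if every product projection of $X$ is coextensive. (Here the word "finite" in parentheses is either read in both places or omitted in both places: the statement holds for categories with finite products and the finite strict refinement property, and for categories with all small products and the strict refinement property.)
   Context: An object $X$ has the (finite) strict refinement property if for any two (finite) product diagrams $(X \xrightarrow{a_i} A_i)_{i \in I}$ and $(X \xrightarrow{b_j} B_j)_{j \in J}$ there exist families of morphisms $(A_i \xrightarrow{\alpha_{i,j}} C_{i,j})_{i\in I,j\in J}$ and $(B_j \xrightarrow{\beta_{i,j}} C_{i,j})_{i\in I, j\in J}$ such that $\alpha_{i,j}a_i =\beta_{i,j}b_j$ for all $i,j$, and such that $(A_i \xrightarrow{\alpha_{i,s}} C_{i,s})_{s\in J}$ and $(B_j \xrightarrow{\beta_{t,j}} C_{t,j})_{t \in I}$ are product diagrams for all $i\in I$ and $j\in J$. A product projection of $X$ is a morphism $X\to A$ that is one leg of some binary product diagram $A \leftarrow X \rightarrow A'$. A morphism $f\colon A \to X$ is coextensive if it satisfies both of the following conditions. (C1) For every product diagram $A_1 \xleftarrow{a_1} A \xrightarrow{a_2} A_2$, the pushouts of $f$ along $a_1$ and along $a_2$ exist, and the resulting morphisms $X_1 \leftarrow X \rightarrow X_2$ (where $X_i$ is the pushout of $f$ along $a_i$) form a product diagram. (C2) For every commutative diagram consisting of morphisms $a_i\colon A\to A_i$, $x_i\colon X \to X_i$, $f_i\colon A_i\to X_i$ with $f_i a_i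 = x_i f$ ($i=1,2$), where $A_1 \xleftarrow{a_1} A \xrightarrow{a_2} A_2$ is a product diagram, if $X_1 \xleftarrow{x_1} X \xrightarrow{x_2} X_2$ is a product diagram, then both squares $f_i a_i = x_i f$ are pushouts. *)

theory Defs
  imports Main
begin

record ('o, 'm) cat =
  Ob :: "'o set"
  Mor :: "'m set"
  Dom :: "'m \<Rightarrow> 'o"
  Cod :: "'m \<Rightarrow> 'o"
  Id :: "'o \<Rightarrow> 'm"
  comp :: "'m \<Rightarrow> 'm \<Rightarrow> 'm"  (infixl "\<odot>\<index>" 70)  (* g \<odot> f is g after f *)

definition Hom :: "('o, 'm, 'z) cat_scheme \<Rightarrow> 'o \<Rightarrow> 'o \<Rightarrow> 'm set" where
  "Hom C X Y = {f \<in> Mor C. Dom C f = X \<and> Cod C f = Y}"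

locale category =
  fixes C (structure)
  assumes Dom_closed: "f \<in> Mor C \<Longrightarrow> Dom C f \<in> Ob C"
    and Cod_closed: "f \<in> Mor C \<Longrightarrow> Cod C f \<in> Ob C"
    and Id_closed: "X \<in> Ob C \<Longrightarrow> Id C X \<in> Hom C X X"
    and comp_closed: "\<lbrakk>f \<in> Hom C X Y; g \<in> Hom C Y Z\<rbrakk> \<Longrightarrow> g \<odot> f \<in> Hom C X Z"
    and comp_Id: "f \<in> Hom C X Y \<Longrightarrow> f \<odot> Id C X = f"
    and Id_comp: "f \<in> Hom C X Y \<Longrightarrow> Id C Y \<odot> f = f"
    and comp_assoc: "\<lbrakk>f \<in> Hom C W X; g \<in> Hom C X Y; h \<in> Hom C Y Z\<rbrakk>
      \<Longrightarrow> h \<odot> (g \<odot> f) = (h \<odot> g) \<odot> f"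

(* Families are total functions of which only the values on the index set I matter.
   For I = {} this says that X is terminal. *)
definition product_diagram ::
  "('o, 'm, 'z) cat_scheme \<Rightarrow> 'o \<Rightarrow> 'i set \<Rightarrow> ('i \<Rightarrow> 'o) \<Rightarrow> ('i \<Rightarrow> 'm) \<Rightarrow> bool" where
  "product_diagram C X I A a \<longleftrightarrow>
     X \<in> Ob C \<and> (\<forall>i\<in>I. a i \<in> Hom C X (A i)) \<and>
     (\<forall>Y\<in>Ob C. \<forall>y. (\<forall>i\<in>I. y i \<in> Hom C Y (A i)) \<longrightarrow>
        (\<exists>!u. u \<in> Hom C Y X \<and> (\<forall>i\<in>I. a i \<odot>\<^bsub>C\<^esub> u = y i)))"

definition binary_product_diagram ::
  "('o, 'm, 'z) cat_scheme \<Rightarrow> 'o \<Rightarrow> 'o \<Rightarrow> 'm \<Rightarrow> 'o \<Rightarrow> 'm \<Rightarrow> bool" where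
  "binary_product_diagram C X A1 a1 A2 a2 \<longleftrightarrow>
     product_diagram C X (UNIV :: bool set) (\<lambda>b. if b then A1 else A2) (\<lambda>b. if b then a1 else a2)"

definition product_projection :: "('o, 'm, 'z) cat_scheme \<Rightarrow> 'o \<Rightarrow> 'm \<Rightarrow> bool" where
  "product_projection C X p \<longleftrightarrow> (\<exists>A A' p'. binary_product_diagram C X A p A' p')"

definition coequalizer :: "('o, 'm, 'z) cat_scheme \<Rightarrow> 'm \<Rightarrow> 'm \<Rightarrow> 'm \<Rightarrow> bool" where
  "coequalizer C g h q \<longleftrightarrow>
     (\<exists>W X Y. g \<in> Hom C W X \<and> h \<in> Hom C W X \<and> q \<in> Hom C X Y \<and>
        q \<odot>\<^bsub>C\<^esub> g = q \<odot>\<^bsub>C\<^esub> h \<and>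
        (\<forall>Z\<in>Ob C. \<forall>k\<in>Hom C X Z. k \<odot>\<^bsub>C\<^esub> g = k \<odot>\<^bsub>C\<^esub> h \<longrightarrow>
           (\<exists>!u. u \<in> Hom C Y Z \<and> u \<odot>\<^bsub>C\<^esub> q = k)))"

definition regular_epi :: "('o, 'm, 'z) cat_scheme \<Rightarrow> 'm \<Rightarrow> bool" where
  "regular_epi C q \<longleftrightarrow> (\<exists>g h. coequalizer C g h q)"

(* The square  f' a = x f  is a pushout, where  a : A \<rightarrow> B,  f : A \<rightarrow> X,  f' : B \<rightarrow> P,  x : X \<rightarrow> P. *)
definition pushout_square :: "('o, 'm, 'z) cat_scheme \<Rightarrow> 'm \<Rightarrow> 'm \<Rightarrow> 'm \<Rightarrow> 'm \<Rightarrow> bool" where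
  "pushout_square C f a x f' \<longleftrightarrow>
     (\<exists>A B X P. f \<in> Hom C A X \<and> a \<in> Hom C A B \<and> x \<in> Hom C X P \<and> f' \<in> Hom C B P \<and>
        f' \<odot>\<^bsub>C\<^esub> a = x \<odot>\<^bsub>C\<^esub> f \<and>
        (\<forall>Z\<in>Ob C. \<forall>v\<in>Hom C X Z. \<forall>w\<in>Hom C B Z. w \<odot>\<^bsub>C\<^esub> a = v \<odot>\<^bsub>C\<^esub> f \<longrightarrow>
           (\<exists>!u. u \<in> Hom C P Z \<and> u \<odot>\<^bsub>C\<^esub> x = v \<and> u \<odot>\<^bsub>C\<^esub> f' = w)))"

definition coextensive_C1 :: "('o, 'm, 'z) cat_scheme \<Rightarrow> 'm \<Rightarrow> bool" where
  "coextensive_C1 C f \<longleftrightarrow>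
     (\<forall>A1 a1 A2 a2. binary_product_diagram C (Dom C f) A1 a1 A2 a2 \<longrightarrow>
        (\<exists>X1 x1 f1 X2 x2 f2.
           pushout_square C f a1 x1 f1 \<and> pushout_square C f a2 x2 f2 \<and>
           binary_product_diagram C (Cod C f) X1 x1 X2 x2))"

definition coextensive_C2 :: "('o, 'm, 'z) cat_scheme \<Rightarrow> 'm \<Rightarrow> bool" where
  "coextensive_C2 C f \<longleftrightarrow>
     (\<forall>A1 a1 A2 a2 X1 x1 X2 x2 f1 f2.
        f1 \<in> Hom C A1 X1 \<and> f2 \<in> Hom C A2 X2 \<and>
        f1 \<odot>\<^bsub>C\<^esub> a1 = x1 \<odot>\<^bsub>C\<^esub> f \<and> f2 \<odot>\<^bsub>C\<^esub> a2 = x2 \<odot>\<^bsub>C\<^esub> f \<and>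
        binary_product_diagram C (Dom C f) A1 a1 A2 a2 \<and>
        binary_product_diagram C (Cod C f) X1 x1 X2 x2 \<longrightarrow>
          pushout_square C f a1 x1 f1 \<and> pushout_square C f a2 x2 f2)"

definition coextensive :: "('o, 'm, 'z) cat_scheme \<Rightarrow> 'm \<Rightarrow> bool" where
  "coextensive C f \<longleftrightarrow> f \<in> Mor C \<and> coextensive_C1 C f \<and> coextensive_C2 C f"

(* A notion of smallness for index sets.  The properties listed are among those of the small
   sets of a Grothendieck universe; they also hold of the finite sets, and of all sets of an
   infinite type 'i (when the sets of that type are taken as the small ones).  The type is
   infinite so that it provides index sets of every finite cardinality. *)
definition smallness :: "('i set \<Rightarrow> bool) \<Rightarrow> bool" where
  "smallness small \<longleftrightarrow>
     infinite (UNIV :: 'i set) \<and>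
     (\<forall>I. finite I \<longrightarrow> small I) \<and>
     (\<forall>I J. small I \<and> J \<subseteq> I \<longrightarrow> small J) \<and>
     (\<forall>I (f :: 'i \<Rightarrow> 'i). small I \<longrightarrow> small (f ` I))"

lemma smallness_finite: "infinite (UNIV :: 'i set) \<Longrightarrow> smallness (finite :: 'i set \<Rightarrow> bool)"
  by (auto simp: smallness_def intro: finite_subset)

lemma smallness_all: "infinite (UNIV :: 'i set) \<Longrightarrow> smallness (\<lambda>I :: 'i set. True)"
  by (simp add: smallness_def)

definition has_products :: "('i set \<Rightarrow> bool) \<Rightarrow> ('o, 'm, 'z) cat_scheme \<Rightarrow> bool" where
  "has_products small C \<longleftrightarrow>
     (\<forall>(I :: 'i set) A. small I \<and> (\<forall>i\<in>I. A i \<in> Ob C) \<longrightarrow> (\<exists>P p. product_diagram C P I A p))"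

definition strict_refinement ::
  "('i set \<Rightarrow> bool) \<Rightarrow> ('o, 'm, 'z) cat_scheme \<Rightarrow> 'o \<Rightarrow> bool" where
  "strict_refinement small C X \<longleftrightarrow>
     (\<forall>(I :: 'i set) (J :: 'i set) A a B b.
        small I \<and> small J \<and> product_diagram C X I A a \<and> product_diagram C X J B b \<longrightarrow>
        (\<exists>D \<alpha> \<beta>.
           (\<forall>i\<in>I. \<forall>j\<in>J. \<alpha> i j \<in> Hom C (A i) (D i j) \<and> \<beta> i j \<in> Hom C (B j) (D i j) \<and>
              \<alpha> i j \<odot>\<^bsub>C\<^esub> a i = \<beta> i j \<odot>\<^bsub>C\<^esub> b j) \<and>
           (\<forall>i\<in>I. product_diagram C (A i) J (D i) (\<alpha> i)) \<and>
           (\<forall>j\<in>J. product_diagram C (B j) I (\<lambda>i. D i j) (\<lambda>i. \<beta> i j))))"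

end

theory Submission
  imports Defs
begin

text \<open>
  Write \<open>X\<close> as \<open>A \<times> A'\<close>. Every pair of generalized elements of \<open>A\<close> extends, after restriction
  along an epimorphism (a projection \<open>W \<times> A' \<rightarrow> W\<close>), to a pair of generalized elements of \<open>X\<close>
  with the same \<open>A'\<close>-component. Since projections are regular epimorphisms, this shows that the
  squares of a refinement are pushouts, which gives (C1), and that
  \<open>\<gamma> \<times> \<gamma>'\<close> is invertible only if \<open>\<gamma>\<close> is, which gives (C2). Conversely, given product diagrams
  \<open>a\<close> and \<open>b\<close> of \<open>X\<close>, (C1) for \<open>b j\<close> splits \<open>B j\<close> as \<open>E i j \<times> E' i j\<close>, hence
  \<open>X\<close> as \<open>(\<Prod>j. E i j) \<times> (\<Prod>j. E' i j)\<close>, and comparing this with \<open>X = A i \<times> A' i\<close> gives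
  \<open>A i = (\<Prod>j. E i j)\<close>. Now every \<open>A i\<close> splits off \<open>E i j\<close>, and the same argument with the
  roles of \<open>a\<close> and \<open>b\<close> exchanged gives \<open>B j = (\<Prod>i. E i j)\<close>.
\<close>

section \<open>Binary product diagrams and two-element index sets\<close>

text \<open>The working form of the definition: the family over \<open>bool\<close> becomes an
  explicit pair of legs, and a test pair is encoded as a boolean family.\<close>

lemma binary_product_diagram_iff:
  "binary_product_diagram C X A a A' a' \<longleftrightarrow>
     X \<in> Ob C \<and> a \<in> Hom C X A \<and> a' \<in> Hom C X A' \<and>
     (\<forall>Y\<in>Ob C. \<forall>y\<in>Hom C Y A. \<forall>y'\<in>Hom C Y A'.
        \<exists>!u. u \<in> Hom C Y X \<and> a \<odot>\<^bsub>C\<^esub> u = y \<and> a' \<odot>\<^bsub>C\<^esub> u = y')"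
  (is "_ \<longleftrightarrow> ?X \<and> ?a \<and> ?a' \<and> ?univ")
proof
  assume prod: "binary_product_diagram C X A a A' a'"
  have ?univ
  proof (intro ballI)
    fix Y y y' assume "Y \<in> Ob C" "y \<in> Hom C Y A" "y' \<in> Hom C Y A'"
    then show "\<exists>!u. u \<in> Hom C Y X \<and> a \<odot>\<^bsub>C\<^esub> u = y \<and> a' \<odot>\<^bsub>C\<^esub> u = y'"
      using prod[unfolded binary_product_diagram_def product_diagram_def,
          THEN conjunct2, THEN conjunct2, rule_format, of Y "\<lambda>b. if b then y else y'"]
      by (simp add: all_bool_eq conj_commute split: if_splits)
  qed
  then show "?X \<and> ?a \<and> ?a' \<and> ?univ"
    using prod by (simp add: binary_product_diagram_def product_diagram_def all_bool_eq)
next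
  assume "?X \<and> ?a \<and> ?a' \<and> ?univ"
  then show "binary_product_diagram C X A a A' a'"
    by (simp add: binary_product_diagram_def product_diagram_def all_bool_eq conj_commute)
qed

lemma binary_product_diagram_commute:
  "binary_product_diagram C X A a A' a' \<longleftrightarrow> binary_product_diagram C X A' a' A a"
proof -
  have "binary_product_diagram C X A' a' A a" if "binary_product_diagram C X A a A' a'" for A a A' a'
    unfolding binary_product_diagram_iff
  proof (intro conjI ballI)
    fix Y y' y assume "Y \<in> Ob C" "y' \<in> Hom C Y A'" "y \<in> Hom C Y A"
    then have "\<exists>!u. u \<in> Hom C Y X \<and> a \<odot>\<^bsub>C\<^esub> u = y \<and> a' \<odot>\<^bsub>C\<^esub> u = y'"
      using that unfolding binary_product_diagram_iff by blast
    then show "\<exists>!u. u \<in> Hom C Y X \<and> a' \<odot>\<^bsub>C\<^esub> u = y' \<and> a \<odot>\<^bsub>C\<^esub> u = y"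
      by (simp add: conj_commute)
  qed (use that in \<open>simp_all add: binary_product_diagram_iff\<close>)
  then show ?thesis by blast
qed

text \<open>The bridge between coextensivity, phrased with diagrams over \<open>bool\<close>, and
  strict refinement, whose index sets live in the type on which \<open>small\<close> is
  defined.\<close>

lemma product_diagram_doubleton_iff:
  assumes "i \<noteq> j"
  shows "product_diagram C X {i, j} A a \<longleftrightarrow>
    binary_product_diagram C X (A i) (a i) (A j) (a j)"
proof
  assume prod: "product_diagram C X {i, j} A a"
  show "binary_product_diagram C X (A i) (a i) (A j) (a j)"
    unfolding binary_product_diagram_iff
  proof (intro conjI ballI)
    fix Y y y' assume Y: "Y \<in> Ob C" and y: "y \<in> Hom C Y (A i)" "y' \<in> Hom C Y (A j)"
    define z where "z k = (if k = i then y else y')" for k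
    have "\<forall>k\<in>{i, j}. z k \<in> Hom C Y (A k)" using y assms by (simp add: z_def)
    then have "\<exists>!u. u \<in> Hom C Y X \<and> (\<forall>k\<in>{i, j}. a k \<odot>\<^bsub>C\<^esub> u = z k)"
      using prod Y unfolding product_diagram_def by blast
    then show "\<exists>!u. u \<in> Hom C Y X \<and> a i \<odot>\<^bsub>C\<^esub> u = y \<and> a j \<odot>\<^bsub>C\<^esub> u = y'"
      using assms by (simp add: z_def)
  qed (use prod in \<open>simp_all add: product_diagram_def\<close>)
qed (simp add: binary_product_diagram_iff product_diagram_def)

lemma smallness_doubleton:
  fixes small :: "'i set \<Rightarrow> bool"
  assumes "smallness small"
  obtains i j where "i \<noteq> j" "small {i, j}"
proof -
  have inf: "infinite (UNIV :: 'i set)" and fin: "\<And>I. finite I \<Longrightarrow> small I"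
    using assms by (simp_all add: smallness_def)
  \<comment> \<open>\<open>undefined\<close> serves as an arbitrary first index; infinity of the
    type provides a second one.\<close>
  obtain j :: 'i where j: "j \<noteq> undefined" using ex_new_if_finite[OF inf, of "{undefined}"] by auto
  show thesis by (rule that[OF j fin]) simp
qed

lemma product_diagram_Hom: "product_diagram C X I A a \<Longrightarrow> i \<in> I \<Longrightarrow> a i \<in> Hom C X (A i)"
  by (simp add: product_diagram_def)

lemma product_diagram_pairing:
  assumes "product_diagram C X I A a" "Y \<in> Ob C" "\<And>i. i \<in> I \<Longrightarrow> y i \<in> Hom C Y (A i)"
  obtains u where "u \<in> Hom C Y X" "\<And>i. i \<in> I \<Longrightarrow> a i \<odot>\<^bsub>C\<^esub> u = y i"
  using assms unfolding product_diagram_def by metis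

lemma binary_product_diagram_Hom:
  assumes "binary_product_diagram C X A a A' a'"
  shows "a \<in> Hom C X A" "a' \<in> Hom C X A'"
  using assms by (simp_all add: binary_product_diagram_iff)

lemma binary_product_diagram_pairing:
  assumes "binary_product_diagram C X A a A' a'" "Y \<in> Ob C" "y \<in> Hom C Y A" "y' \<in> Hom C Y A'"
  obtains u where "u \<in> Hom C Y X" "a \<odot>\<^bsub>C\<^esub> u = y" "a' \<odot>\<^bsub>C\<^esub> u = y'"
  using assms unfolding binary_product_diagram_iff by metis

lemma product_projectionI:
  assumes "binary_product_diagram C X A a A' a'"
  shows "product_projection C X a" "product_projection C X a'"
  using assms binary_product_diagram_commute unfolding product_projection_def by metis+

section \<open>Product diagrams inside a category\<close>

context category
begin

lemma Hom_Ob: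
  assumes "f \<in> Hom C X Y"
  shows "X \<in> Ob C" "Y \<in> Ob C"
  using assms Dom_closed Cod_closed by (auto simp: Hom_def)

text \<open>Both morphisms mediate the family \<open>a i \<odot> u\<close>, so the uniqueness clause
  identifies them: the legs are jointly monic.\<close>

lemma product_diagram_eqI:
  assumes prod: "product_diagram C X I A a" and u: "u \<in> Hom C Y X" and v: "v \<in> Hom C Y X"
    and eq: "\<And>i. i \<in> I \<Longrightarrow> a i \<odot> u = a i \<odot> v"
  shows "u = v"
proof -
  have "\<forall>i\<in>I. a i \<odot> u \<in> Hom C Y (A i)"
    using comp_closed[OF u product_diagram_Hom[OF prod]] by blast
  then have "\<exists>!w. w \<in> Hom C Y X \<and> (\<forall>i\<in>I. a i \<odot> w = a i \<odot> u)"
    using prod Hom_Ob(1)[OF u] unfolding product_diagram_def by simp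
  then show ?thesis using u v eq by metis
qed

lemma binary_product_diagram_eqI:
  assumes prod: "binary_product_diagram C X A a A' a'" and "u \<in> Hom C Y X" "v \<in> Hom C Y X"
    and "a \<odot> u = a \<odot> v" "a' \<odot> u = a' \<odot> v"
  shows "u = v"
  using product_diagram_eqI[OF prod[unfolded binary_product_diagram_def]] assms(2-) by simp

text \<open>Evaluates a commutative square at a generalized element \<open>e\<close>; the later
  elementwise arguments rest on it.\<close>

lemma comp_square:
  assumes "g \<odot> f = g' \<odot> f'" "e \<in> Hom C W X"
    "f \<in> Hom C X Y" "g \<in> Hom C Y Z" "f' \<in> Hom C X Y'" "g' \<in> Hom C Y' Z"
  shows "g \<odot> (f \<odot> e) = g' \<odot> (f' \<odot> e)"
  using comp_assoc[OF assms(2-4)] comp_assoc[OF assms(2,5,6)] assms(1) by simp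

lemma pushout_square_factor:
  assumes po: "pushout_square C f a x f'"
    and a: "a \<in> Hom C A B" and x: "x \<in> Hom C X P"
    and v: "v \<in> Hom C X Z" and w: "w \<in> Hom C B Z" and eq: "w \<odot> a = v \<odot> f"
  obtains u where "u \<in> Hom C P Z" "u \<odot> x = v"
proof -
  obtain A' B' X' P' where *: "a \<in> Hom C A' B'" "x \<in> Hom C X' P'"
    and univ: "\<forall>Z\<in>Ob C. \<forall>v\<in>Hom C X' Z. \<forall>w\<in>Hom C B' Z. w \<odot> a = v \<odot> f \<longrightarrow>
       (\<exists>!u. u \<in> Hom C P' Z \<and> u \<odot> x = v \<and> u \<odot> f' = w)"
    using po unfolding pushout_square_def by blast
  \<comment> \<open>The objects are existentially bound in \<open>pushout_square\<close>, but as
    domains and codomains of given arrows they must be the named ones.\<close>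
  have "B' = B" "X' = X" "P' = P" using * a x by (auto simp: Hom_def)
  then show thesis using that univ[rule_format, OF Hom_Ob(2)[OF v], of v w] v w eq by auto
qed

lemma product_diagram_iso:
  assumes prod: "product_diagram C P I A \<pi>"
    and h: "h \<in> Hom C X P" and k: "k \<in> Hom C P X"
    and hk: "h \<odot> k = Id C P" and kh: "k \<odot> h = Id C X"
    and a: "\<And>i. i \<in> I \<Longrightarrow> \<pi> i \<odot> h = a i"
  shows "product_diagram C X I A a"
  unfolding product_diagram_def
proof (intro conjI ballI allI impI)
  show "X \<in> Ob C" using Hom_Ob(1)[OF h] .
  show "a i \<in> Hom C X (A i)" if "i \<in> I" for i
    using comp_closed[OF h product_diagram_Hom[OF prod that]] a[OF that] by simp
  fix Y y assume Y: "Y \<in> Ob C" and y: "\<forall>i\<in>I. y i \<in> Hom C Y (A i)"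
  obtain u where u: "u \<in> Hom C Y P" "\<And>i. i \<in> I \<Longrightarrow> \<pi> i \<odot> u = y i"
    using product_diagram_pairing[OF prod Y, of y] y by blast
  show "\<exists>!v. v \<in> Hom C Y X \<and> (\<forall>i\<in>I. a i \<odot> v = y i)"
  proof (rule ex1I[of _ "k \<odot> u"], intro conjI ballI)
    show "k \<odot> u \<in> Hom C Y X" using comp_closed[OF u(1) k] .
    have "h \<odot> (k \<odot> u) = u" using comp_assoc[OF u(1) k h] hk Id_comp[OF u(1)] by simp
    then show "a i \<odot> (k \<odot> u) = y i" if "i \<in> I" for i
      using comp_assoc[OF comp_closed[OF u(1) k] h product_diagram_Hom[OF prod that]]
        a[OF that] u(2)[OF that] by simp
  next
    fix v assume v: "v \<in> Hom C Y X \<and> (\<forall>i\<in>I. a i \<odot> v = y i)"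
    have "h \<odot> v = u"
    proof (rule product_diagram_eqI[OF prod])
      fix i assume "i \<in> I"
      then show "\<pi> i \<odot> (h \<odot> v) = \<pi> i \<odot> u"
        using comp_assoc[of v Y X h P "\<pi> i" "A i"] v h product_diagram_Hom[OF prod] a u(2) by simp
    qed (use v h u comp_closed in blast)+
    then show "v = k \<odot> u"
      using comp_assoc[of v Y X h P k X] v h k kh Id_comp[of v Y X] by simp
  qed
qed

text \<open>A product over \<open>J\<close> is interchanged with a binary one. Elements of
  \<open>P\<close> and \<open>P'\<close> have components in \<open>E j\<close> and
  \<open>E' j\<close>, which form an element \<open>z j\<close> of \<open>B j\<close>; these
  assemble to an element of \<open>X\<close>.\<close>

lemma binary_product_diagram_of_products:
  assumes X: "product_diagram C X J B b"
    and B: "\<And>j. j \<in> J \<Longrightarrow> binary_product_diagram C (B j) (E j) (\<beta> j) (E' j) (\<beta>' j)"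
    and P: "product_diagram C P J E \<pi>" and P': "product_diagram C P' J E' \<pi>'"
    and d: "d \<in> Hom C X P" "\<And>j. j \<in> J \<Longrightarrow> \<pi> j \<odot> d = \<beta> j \<odot> b j"
    and d': "d' \<in> Hom C X P'" "\<And>j. j \<in> J \<Longrightarrow> \<pi>' j \<odot> d' = \<beta>' j \<odot> b j"
  shows "binary_product_diagram C X P d P' d'"
  unfolding binary_product_diagram_iff
proof (intro conjI ballI)
  show "X \<in> Ob C" using Hom_Ob(1)[OF d(1)] .
  note b = product_diagram_Hom[OF X] and \<beta> = binary_product_diagram_Hom[OF B]
    and \<pi> = product_diagram_Hom[OF P] and \<pi>' = product_diagram_Hom[OF P']
  have sq: "\<pi> j \<odot> (d \<odot> u) = \<beta> j \<odot> (b j \<odot> u)" "\<pi>' j \<odot> (d' \<odot> u) = \<beta>' j \<odot> (b j \<odot> u)"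
    if "j \<in> J" "u \<in> Hom C Y X" for j u Y
    using comp_square[OF d(2) that(2) d(1) \<pi> b \<beta>(1)]
      comp_square[OF d'(2) that(2) d'(1) \<pi>' b \<beta>(2)] that(1) by auto
  fix Y y y' assume Y: "Y \<in> Ob C" and y: "y \<in> Hom C Y P" and y': "y' \<in> Hom C Y P'"
  have "\<exists>z. z \<in> Hom C Y (B j) \<and> \<beta> j \<odot> z = \<pi> j \<odot> y \<and> \<beta>' j \<odot> z = \<pi>' j \<odot> y'" if "j \<in> J" for j
    using binary_product_diagram_pairing[OF B[OF that] Y comp_closed[OF y \<pi>[OF that]]
        comp_closed[OF y' \<pi>'[OF that]]] by metis
  then obtain z where z: "\<And>j. j \<in> J \<Longrightarrow>
      z j \<in> Hom C Y (B j) \<and> \<beta> j \<odot> z j = \<pi> j \<odot> y \<and> \<beta>' j \<odot> z j = \<pi>' j \<odot> y'"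
    by metis
  then obtain u where u: "u \<in> Hom C Y X" "\<And>j. j \<in> J \<Longrightarrow> b j \<odot> u = z j"
    using product_diagram_pairing[OF X Y, of z] by blast
  show "\<exists>!u. u \<in> Hom C Y X \<and> d \<odot> u = y \<and> d' \<odot> u = y'"
  proof (rule ex1I[of _ u], intro conjI)
    show "u \<in> Hom C Y X" by fact
    show "d \<odot> u = y"
      by (rule product_diagram_eqI[OF P comp_closed[OF u(1) d(1)] y]) (simp add: sq(1)[OF _ u(1)] u z)
    show "d' \<odot> u = y'"
      by (rule product_diagram_eqI[OF P' comp_closed[OF u(1) d'(1)] y']) (simp add: sq(2)[OF _ u(1)] u z)
  next
    fix v assume v: "v \<in> Hom C Y X \<and> d \<odot> v = y \<and> d' \<odot> v = y'"
    then have vX: "v \<in> Hom C Y X" by simp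
    show "v = u"
    proof (rule product_diagram_eqI[OF X vX u(1)])
      fix j assume j: "j \<in> J"
      show "b j \<odot> v = b j \<odot> u"
        using binary_product_diagram_eqI[OF B[OF j] comp_closed[OF vX b[OF j]], of "z j"]
          sq[OF j vX] v z[OF j] u(2)[OF j] by simp
    qed
  qed
qed (fact d d')+

text \<open>Associativity of products, with the remaining factors collected in \<open>P\<close>. It
  exhibits a leg of an arbitrary product diagram as a product projection.\<close>

lemma product_diagram_split:
  assumes X: "product_diagram C X I A a" and i: "i \<in> I"
    and P: "product_diagram C P (I - {i}) A q"
  obtains p where "binary_product_diagram C X (A i) (a i) P p"
    "\<And>k. k \<in> I - {i} \<Longrightarrow> q k \<odot> p = a k"
proof -
  note a = product_diagram_Hom[OF X] and q = product_diagram_Hom[OF P]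
  have X_Ob: "X \<in> Ob C" using Hom_Ob(1)[OF a[OF i]] .
  obtain p where p: "p \<in> Hom C X P" "\<And>k. k \<in> I - {i} \<Longrightarrow> q k \<odot> p = a k"
    using product_diagram_pairing[OF P X_Ob, of a] a by blast
  have qp: "q k \<odot> (p \<odot> u) = a k \<odot> u" if "k \<in> I - {i}" "u \<in> Hom C Y X" for k u Y
    using comp_assoc[OF that(2) p(1) q[OF that(1)]] p(2)[OF that(1)] by simp
  have "binary_product_diagram C X (A i) (a i) P p"
    unfolding binary_product_diagram_iff
  proof (intro conjI ballI)
    fix Y y y' assume Y: "Y \<in> Ob C" and y: "y \<in> Hom C Y (A i)" and y': "y' \<in> Hom C Y P"
    \<comment> \<open>The pair is unpacked into a family over \<open>I\<close>: \<open>y\<close> at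
      \<open>i\<close>, the components of \<open>y'\<close> elsewhere.\<close>
    define z where "z k = (if k = i then y else q k \<odot> y')" for k
    have "z k \<in> Hom C Y (A k)" if "k \<in> I" for k
      using y comp_closed[OF y' q] that by (auto simp: z_def)
    then obtain u where u: "u \<in> Hom C Y X" "\<And>k. k \<in> I \<Longrightarrow> a k \<odot> u = z k"
      using product_diagram_pairing[OF X Y, of z] by blast
    show "\<exists>!u. u \<in> Hom C Y X \<and> a i \<odot> u = y \<and> p \<odot> u = y'"
    proof (rule ex1I[of _ u], intro conjI)
      show "u \<in> Hom C Y X" by fact
      show "a i \<odot> u = y" using u(2)[OF i] by (simp add: z_def)
      show "p \<odot> u = y'"
        by (rule product_diagram_eqI[OF P comp_closed[OF u(1) p(1)] y'])
          (simp add: qp[OF _ u(1)] u(2) z_def)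
    next
      fix v assume v: "v \<in> Hom C Y X \<and> a i \<odot> v = y \<and> p \<odot> v = y'"
      then have vX: "v \<in> Hom C Y X" by simp
      show "v = u"
      proof (rule product_diagram_eqI[OF X vX u(1)])
        fix k assume "k \<in> I"
        then show "a k \<odot> v = a k \<odot> u"
          using v qp[OF _ vX, of k] u(2) by (cases "k = i") (simp_all add: z_def)
      qed
    qed
  qed (use X_Ob a[OF i] p(1) in auto)
  then show thesis using that p(2) by blast
qed

end

section \<open>Product projections that are regular epimorphisms\<close>

text \<open>Asking only for binary products keeps the locale free of an index type, so it serves
  every \<open>small\<close>; larger products enter through hypotheses of the lemmas.\<close>

locale regular_projections = category +
  assumes binary_products: "\<lbrakk>A \<in> Ob C; A' \<in> Ob C\<rbrakk> \<Longrightarrow> \<exists>P p p'. binary_product_diagram C P A p A' p'"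
    and projection_regular_epi: "product_projection C Y p \<Longrightarrow> regular_epi C p"
begin

lemma projection_coequalizer:
  assumes "product_projection C X p" "p \<in> Hom C X A"
  shows "\<exists>W g h. g \<in> Hom C W X \<and> h \<in> Hom C W X \<and> p \<odot> g = p \<odot> h \<and>
    (\<forall>Z. \<forall>k\<in>Hom C X Z. k \<odot> g = k \<odot> h \<longrightarrow> (\<exists>!u. u \<in> Hom C A Z \<and> u \<odot> p = k))"
proof -
  obtain g h W X' A' where q: "g \<in> Hom C W X'" "h \<in> Hom C W X'" "p \<in> Hom C X' A'" "p \<odot> g = p \<odot> h"
    "\<forall>Z\<in>Ob C. \<forall>k\<in>Hom C X' Z. k \<odot> g = k \<odot> h \<longrightarrow> (\<exists>!u. u \<in> Hom C A' Z \<and> u \<odot> p = k)"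
    using projection_regular_epi[OF assms(1)] unfolding regular_epi_def coequalizer_def by blast
  have "X' = X" "A' = A" using q(3) assms(2) by (auto simp: Hom_def)
  then show ?thesis using q Hom_Ob(2) by blast
qed

text \<open>Both \<open>u\<close> and \<open>v\<close> are the unique factorization of
  \<open>u \<odot> p\<close> through the coequalizer \<open>p\<close>.\<close>

lemma projection_epi:
  assumes p: "product_projection C X p" "p \<in> Hom C X A"
    and u: "u \<in> Hom C A Z" and v: "v \<in> Hom C A Z" and eq: "u \<odot> p = v \<odot> p"
  shows "u = v"
proof -
  obtain W g h where gh: "g \<in> Hom C W X" "h \<in> Hom C W X" "p \<odot> g = p \<odot> h"
    and coeq: "\<forall>Z. \<forall>k\<in>Hom C X Z. k \<odot> g = k \<odot> h \<longrightarrow> (\<exists>!u. u \<in> Hom C A Z \<and> u \<odot> p = k)"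
    using projection_coequalizer[OF p] by blast
  have "(u \<odot> p) \<odot> g = (u \<odot> p) \<odot> h"
    using comp_assoc[OF gh(1) p(2) u] comp_assoc[OF gh(2) p(2) u] gh(3) by simp
  then show ?thesis using coeq[rule_format, OF comp_closed[OF p(2) u]] u v eq by metis
qed

text \<open>The parallel pair with coequalizer \<open>p\<close> is an instance of
  \<open>ker\<close>. Quantifying over all pairs allows an elementwise check that \<open>v\<close>
  identifies whatever \<open>p\<close> identifies.\<close>

lemma projection_factor:
  assumes p: "product_projection C X p" "p \<in> Hom C X A" and v: "v \<in> Hom C X Z"
    and ker: "\<And>W g h. \<lbrakk>g \<in> Hom C W X; h \<in> Hom C W X; p \<odot> g = p \<odot> h\<rbrakk> \<Longrightarrow> v \<odot> g = v \<odot> h"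
  obtains u where "u \<in> Hom C A Z" "u \<odot> p = v"
  using projection_coequalizer[OF p] v ker by metis

text \<open>Over \<open>W\<close> there may be no element of \<open>A'\<close> with which to
  complete \<open>g\<close> and \<open>h\<close>. Over \<open>V\<close>, a product of
  \<open>W\<close> and \<open>A'\<close>, the projection \<open>e'\<close> is such an element, and
  it completes both. Equations over \<open>V\<close> descend to \<open>W\<close> because
  \<open>e\<close> is an epimorphism.\<close>

lemma lift_parallel_pair:
  assumes X: "binary_product_diagram C X A p A' p'"
    and g: "g \<in> Hom C W A" and h: "h \<in> Hom C W A"
  obtains V e s t where "product_projection C V e" "e \<in> Hom C V W" "s \<in> Hom C V X" "t \<in> Hom C V X"
    "p \<odot> s = g \<odot> e" "p \<odot> t = h \<odot> e" "p' \<odot> s = p' \<odot> t"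
proof -
  obtain V e e' where V: "binary_product_diagram C V W e A' e'"
    using binary_products Hom_Ob[OF g] Hom_Ob[OF binary_product_diagram_Hom(2)[OF X]] by blast
  note e = binary_product_diagram_Hom[OF V]
  obtain s where s: "s \<in> Hom C V X" "p \<odot> s = g \<odot> e" "p' \<odot> s = e'"
    using binary_product_diagram_pairing[OF X Hom_Ob(1)[OF e(1)] comp_closed[OF e(1) g] e(2)] .
  obtain t where t: "t \<in> Hom C V X" "p \<odot> t = h \<odot> e" "p' \<odot> t = e'"
    using binary_product_diagram_pairing[OF X Hom_Ob(1)[OF e(1)] comp_closed[OF e(1) h] e(2)] .
  show thesis using that[OF product_projectionI(1)[OF V] e(1) s(1) t(1)] s t by simp
qed

text \<open>
  As \<open>f\<close> and \<open>d\<close> are epimorphisms, \<open>k\<close> is inverse to \<open>\<gamma>\<close>: a morphism is invertible if its product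
  with some other morphism is.
\<close>

lemma projection_comparison:
  assumes X: "binary_product_diagram C X A f A' f'" and Y: "binary_product_diagram C X D d D' d'"
    and \<gamma>: "\<gamma> \<in> Hom C A D" "\<gamma> \<odot> f = d" and \<gamma>': "\<gamma>' \<in> Hom C A' D'" "\<gamma>' \<odot> f' = d'"
  obtains k where "k \<in> Hom C D A" "k \<odot> d = f"
proof (rule projection_factor[OF product_projectionI(1)[OF Y]])
  note f = binary_product_diagram_Hom[OF X]
  show "d \<in> Hom C X D" "f \<in> Hom C X A" using binary_product_diagram_Hom[OF Y] f by auto
  fix W g h assume g: "g \<in> Hom C W X" and h: "h \<in> Hom C W X" and eq: "d \<odot> g = d \<odot> h"
  \<comment> \<open>To factor \<open>f\<close> through \<open>d\<close>, the pair \<open>g\<close>,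
    \<open>h\<close> is replaced by \<open>s\<close>, \<open>t\<close>, which share their
    \<open>A'\<close>-component. Hence not only \<open>d\<close> but also \<open>d'\<close>
    identifies them.\<close>
  obtain V e s t where e: "product_projection C V e" "e \<in> Hom C V W"
    and st: "s \<in> Hom C V X" "t \<in> Hom C V X"
    and fst: "f \<odot> s = (f \<odot> g) \<odot> e" "f \<odot> t = (f \<odot> h) \<odot> e" "f' \<odot> s = f' \<odot> t"
    using lift_parallel_pair[OF X comp_closed[OF g f(1)] comp_closed[OF h f(1)]] by metis
  have "\<gamma> \<odot> (f \<odot> g) = \<gamma> \<odot> (f \<odot> h)"
    using comp_assoc[OF g f(1) \<gamma>(1)] comp_assoc[OF h f(1) \<gamma>(1)] \<gamma>(2) eq by simp
  then have "\<gamma> \<odot> (f \<odot> s) = \<gamma> \<odot> (f \<odot> t)"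
    using comp_square[OF _ e(2) comp_closed[OF g f(1)] \<gamma>(1) comp_closed[OF h f(1)] \<gamma>(1)] fst by simp
  then have "d \<odot> s = d \<odot> t"
    using comp_assoc[OF st(1) f(1) \<gamma>(1)] comp_assoc[OF st(2) f(1) \<gamma>(1)] \<gamma>(2) by simp
  moreover have "d' \<odot> s = d' \<odot> t"
    using comp_assoc[OF st(1) f(2) \<gamma>'(1)] comp_assoc[OF st(2) f(2) \<gamma>'(1)] \<gamma>'(2) fst(3) by simp
  ultimately have "s = t" using binary_product_diagram_eqI[OF Y st] by simp
  then have "(f \<odot> g) \<odot> e = (f \<odot> h) \<odot> e" using fst by simp
  then show "f \<odot> g = f \<odot> h"
    using projection_epi[OF e comp_closed[OF g f(1)] comp_closed[OF h f(1)]] by simp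
qed

section \<open>Pushout squares, and (C2) as a consequence of (C1)\<close>

text \<open>Once \<open>v\<close> factors through \<open>\<alpha>\<close>, compatibility with
  \<open>w\<close> is tested after the epimorphism \<open>x\<close>, and uniqueness after the
  epimorphism \<open>\<alpha>\<close>.\<close>

lemma pushout_squareI:
  assumes f: "f \<in> Hom C X A" and x: "product_projection C X x" "x \<in> Hom C X Y"
    and \<alpha>: "product_projection C A \<alpha>" "\<alpha> \<in> Hom C A P" and \<beta>: "\<beta> \<in> Hom C Y P"
    and sq: "\<beta> \<odot> x = \<alpha> \<odot> f"
    and factor: "\<And>Z v w. \<lbrakk>v \<in> Hom C A Z; w \<in> Hom C Y Z; w \<odot> x = v \<odot> f\<rbrakk>
      \<Longrightarrow> \<exists>u\<in>Hom C P Z. u \<odot> \<alpha> = v"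
  shows "pushout_square C f x \<alpha> \<beta>"
  unfolding pushout_square_def
proof (intro exI conjI ballI impI)
  fix Z v w assume v: "v \<in> Hom C A Z" and w: "w \<in> Hom C Y Z" and eq: "w \<odot> x = v \<odot> f"
  obtain u where u: "u \<in> Hom C P Z" "u \<odot> \<alpha> = v" using factor[OF v w eq] by blast
  have "(u \<odot> \<beta>) \<odot> x = w \<odot> x"
    using comp_assoc[OF x(2) \<beta> u(1)] comp_assoc[OF f \<alpha>(2) u(1)] sq u(2) eq by simp
  then have "u \<odot> \<beta> = w" using projection_epi[OF x comp_closed[OF \<beta> u(1)] w] by simp
  then show "\<exists>!u. u \<in> Hom C P Z \<and> u \<odot> \<alpha> = v \<and> u \<odot> \<beta> = w"
    using u projection_epi[OF \<alpha>] by metis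
qed (fact f x \<alpha> \<beta> sq)+

text \<open>Elements of \<open>A\<close> identified by \<open>\<alpha>\<close> lift to elements
  \<open>s\<close>, \<open>t\<close> of \<open>X\<close> with equal \<open>A'\<close>-component.
  Then \<open>\<beta>\<close> and \<open>\<beta>'\<close> both identify their images under
  \<open>x\<close>, so these images agree. As \<open>v \<odot> p\<close> factors through
  \<open>x\<close>, \<open>v\<close> identifies the given elements as well, and therefore factors
  through \<open>\<alpha>\<close>.\<close>

lemma refinement_pushout:
  assumes X: "binary_product_diagram C X A p A' p'" and x: "product_projection C X x" "x \<in> Hom C X Y"
    and Y: "binary_product_diagram C Y E \<beta> E' \<beta>'"
    and \<alpha>: "product_projection C A \<alpha>" "\<alpha> \<in> Hom C A E" and \<alpha>': "\<alpha>' \<in> Hom C A' E'"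
    and sq: "\<alpha> \<odot> p = \<beta> \<odot> x" "\<alpha>' \<odot> p' = \<beta>' \<odot> x"
  shows "pushout_square C p x \<alpha> \<beta>"
proof (rule pushout_squareI)
  note p = binary_product_diagram_Hom[OF X] and \<beta> = binary_product_diagram_Hom[OF Y]
  show "p \<in> Hom C X A" "\<beta> \<in> Hom C Y E" using p \<beta> by auto
  show "\<beta> \<odot> x = \<alpha> \<odot> p" using sq by simp
  fix Z v w assume v: "v \<in> Hom C A Z" and w: "w \<in> Hom C Y Z" and eq: "w \<odot> x = v \<odot> p"
  have "v \<odot> g = v \<odot> h"
    if g: "g \<in> Hom C W A" and h: "h \<in> Hom C W A" and gh: "\<alpha> \<odot> g = \<alpha> \<odot> h" for W g h
  proof -
    obtain V e s t where e: "product_projection C V e" "e \<in> Hom C V W"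
      and st: "s \<in> Hom C V X" "t \<in> Hom C V X"
      and pst: "p \<odot> s = g \<odot> e" "p \<odot> t = h \<odot> e" "p' \<odot> s = p' \<odot> t"
      using lift_parallel_pair[OF X g h] by metis
    have "x \<odot> s = x \<odot> t"
    proof (rule binary_product_diagram_eqI[OF Y comp_closed[OF st(1) x(2)] comp_closed[OF st(2) x(2)]])
      have "\<alpha> \<odot> (p \<odot> s) = \<alpha> \<odot> (p \<odot> t)"
        unfolding pst using comp_square[OF gh e(2) g \<alpha>(2) h \<alpha>(2)] .
      then show "\<beta> \<odot> (x \<odot> s) = \<beta> \<odot> (x \<odot> t)"
        using comp_square[OF sq(1) st(1) p(1) \<alpha>(2) x(2) \<beta>(1)]
          comp_square[OF sq(1) st(2) p(1) \<alpha>(2) x(2) \<beta>(1)] by simp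
      show "\<beta>' \<odot> (x \<odot> s) = \<beta>' \<odot> (x \<odot> t)"
        using comp_square[OF sq(2) st(1) p(2) \<alpha>' x(2) \<beta>(2)]
          comp_square[OF sq(2) st(2) p(2) \<alpha>' x(2) \<beta>(2)] pst(3) by simp
    qed
    then have "v \<odot> (g \<odot> e) = v \<odot> (h \<odot> e)"
      using comp_square[OF eq st(1) x(2) w p(1) v] comp_square[OF eq st(2) x(2) w p(1) v] pst
      by simp
    then have "(v \<odot> g) \<odot> e = (v \<odot> h) \<odot> e"
      using comp_assoc[OF e(2) g v] comp_assoc[OF e(2) h v] by simp
    then show ?thesis using projection_epi[OF e comp_closed[OF g v] comp_closed[OF h v]] by simp
  qed
  then show "\<exists>u\<in>Hom C E Z. u \<odot> \<alpha> = v" using projection_factor[OF \<alpha> v] by metis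
qed (fact x \<alpha>)+

text \<open>The pushouts from (C1) map to the given squares by \<open>u1\<close> and
  \<open>u2\<close>, which compare two product decompositions of the codomain of \<open>f\<close>.
  By \<open>projection_comparison\<close>, \<open>y1\<close> factors through \<open>x1\<close>, so
  factorizations through \<open>y1\<close> become factorizations through \<open>x1\<close>.\<close>

lemma coextensive_C1_imp_C2:
  assumes f: "f \<in> Mor C" and C1: "coextensive_C1 C f"
  shows "coextensive_C2 C f"
proof -
  \<comment> \<open>One square is enough: the hypotheses are symmetric in the two indices.\<close>
  have *: "pushout_square C f a1 x1 f1"
    if f1: "f1 \<in> Hom C A1 X1" and f2: "f2 \<in> Hom C A2 X2"
      and sq1: "f1 \<odot> a1 = x1 \<odot> f" and sq2: "f2 \<odot> a2 = x2 \<odot> f"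
      and A: "binary_product_diagram C (Dom C f) A1 a1 A2 a2"
      and X: "binary_product_diagram C (Cod C f) X1 x1 X2 x2"
    for A1 a1 A2 a2 X1 x1 X2 x2 f1 f2
  proof (rule pushout_squareI)
    obtain P1 y1 g1 P2 y2 g2 where po: "pushout_square C f a1 y1 g1" "pushout_square C f a2 y2 g2"
      and P: "binary_product_diagram C (Cod C f) P1 y1 P2 y2"
      using C1 A unfolding coextensive_C1_def by blast
    note a = binary_product_diagram_Hom[OF A] and x = binary_product_diagram_Hom[OF X]
      and y = binary_product_diagram_Hom[OF P]
    obtain u1 where u1: "u1 \<in> Hom C P1 X1" "u1 \<odot> y1 = x1"
      by (rule pushout_square_factor[OF po(1) a(1) y(1) x(1) f1 sq1])
    obtain u2 where u2: "u2 \<in> Hom C P2 X2" "u2 \<odot> y2 = x2"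
      by (rule pushout_square_factor[OF po(2) a(2) y(2) x(2) f2 sq2])
    obtain k where k: "k \<in> Hom C X1 P1" "k \<odot> x1 = y1"
      using projection_comparison[OF P X u1 u2] .
    show "\<exists>u\<in>Hom C X1 Z. u \<odot> x1 = v"
      if v: "v \<in> Hom C (Cod C f) Z" and w: "w \<in> Hom C A1 Z" "w \<odot> a1 = v \<odot> f" for Z v w
    proof -
      obtain u where u: "u \<in> Hom C P1 Z" "u \<odot> y1 = v"
        by (rule pushout_square_factor[OF po(1) a(1) y(1) v w])
      then have "(u \<odot> k) \<odot> x1 = v" using comp_assoc[OF x(1) k(1) u(1)] k(2) by simp
      then show ?thesis using comp_closed[OF k(1) u(1)] by blast
    qed
    show "a1 \<in> Hom C (Dom C f) A1" "x1 \<in> Hom C (Cod C f) X1" by (fact a x)+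
    show "f \<in> Hom C (Dom C f) (Cod C f)" using f by (simp add: Hom_def)
  qed (fact f1 sq1 product_projectionI(1)[OF A] product_projectionI(1)[OF X])+
  show ?thesis
    unfolding coextensive_C2_def
  proof (intro allI impI, elim conjE, intro conjI)
    fix A1 a1 A2 a2 X1 x1 X2 x2 f1 f2
    assume "f1 \<in> Hom C A1 X1" "f2 \<in> Hom C A2 X2" "f1 \<odot> a1 = x1 \<odot> f" "f2 \<odot> a2 = x2 \<odot> f"
      "binary_product_diagram C (Dom C f) A1 a1 A2 a2"
      "binary_product_diagram C (Cod C f) X1 x1 X2 x2"
    note H = this
    show "pushout_square C f a1 x1 f1" using *[OF H] .
    show "pushout_square C f a2 x2 f2"
      using *[OF H(2,1,4,3)] H(5,6) binary_product_diagram_commute by metis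
  qed
qed

section \<open>From strict refinement to coextensivity\<close>

text \<open>Refining \<open>A\<close>, \<open>A'\<close> against a binary decomposition of
  \<open>X\<close> gives a two-by-two array. Its row over \<open>A\<close> is the product diagram
  demanded by (C1), and \<open>refinement_pushout\<close>, applied to each column, yields the
  pushouts.\<close>

lemma strict_refinement_imp_coextensive:
  fixes small :: "'i set \<Rightarrow> bool"
  assumes small: "smallness small" and ref: "strict_refinement small C X"
    and p: "product_projection C X p"
  shows "coextensive C p"
proof -
  obtain A A' p' where X: "binary_product_diagram C X A p A' p'"
    using p unfolding product_projection_def by blast
  note pH = binary_product_diagram_Hom[OF X]
  have Mor: "p \<in> Mor C" and Dom: "Dom C p = X" and Cod: "Cod C p = A"
    using pH(1) by (auto simp: Hom_def)
  obtain i j :: 'i where ij: "i \<noteq> j" and "small {i, j}"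
    using smallness_doubleton[OF small] .
  have "coextensive_C1 C p"
    unfolding coextensive_C1_def Dom Cod
  proof (intro allI impI)
    fix X1 x1 X2 x2 assume X12: "binary_product_diagram C X X1 x1 X2 x2"
    note x = binary_product_diagram_Hom[OF X12]
    define F f G g where defs: "F = (\<lambda>k. if k = i then A else A')" "f = (\<lambda>k. if k = i then p else p')"
      "G = (\<lambda>k. if k = i then X1 else X2)" "g = (\<lambda>k. if k = i then x1 else x2)"
    have "product_diagram C X {i, j} F f" "product_diagram C X {i, j} G g"
      using X X12 ij by (simp_all add: product_diagram_doubleton_iff[OF ij] defs)
    then obtain E \<alpha> \<beta> where sq: "\<forall>k\<in>{i, j}. \<forall>l\<in>{i, j}. \<alpha> k l \<in> Hom C (F k) (E k l) \<and>
        \<beta> k l \<in> Hom C (G l) (E k l) \<and> \<alpha> k l \<odot> f k = \<beta> k l \<odot> g l"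
      and rows: "\<forall>k\<in>{i, j}. product_diagram C (F k) {i, j} (E k) (\<alpha> k)"
      and cols: "\<forall>l\<in>{i, j}. product_diagram C (G l) {i, j} (\<lambda>k. E k l) (\<lambda>k. \<beta> k l)"
      using ref[unfolded strict_refinement_def, rule_format, of "{i, j}" "{i, j}" F f G g]
        \<open>small {i, j}\<close> by blast
    \<comment> \<open>The indices \<open>i\<close>, \<open>j\<close> label both rows and columns;
      row \<open>i\<close> belongs to \<open>A\<close>, column \<open>i\<close> to
      \<open>X1\<close>.\<close>
    have row: "binary_product_diagram C A (E i i) (\<alpha> i i) (E i j) (\<alpha> i j)"
      using rows product_diagram_doubleton_iff[OF ij, of C A "E i" "\<alpha> i"] by (simp add: defs)
    have "binary_product_diagram C X1 (E i i) (\<beta> i i) (E j i) (\<beta> j i)"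
      "binary_product_diagram C X2 (E i j) (\<beta> i j) (E j j) (\<beta> j j)"
      using cols product_diagram_doubleton_iff[OF ij, of C X1 "\<lambda>k. E k i" "\<lambda>k. \<beta> k i"]
        product_diagram_doubleton_iff[OF ij, of C X2 "\<lambda>k. E k j" "\<lambda>k. \<beta> k j"] ij
      by (simp_all add: defs)
    note col = this
    note \<alpha> = binary_product_diagram_Hom[OF row]
    have "\<alpha> j i \<in> Hom C A' (E j i)" "\<alpha> j j \<in> Hom C A' (E j j)"
      "\<alpha> i i \<odot> p = \<beta> i i \<odot> x1" "\<alpha> j i \<odot> p' = \<beta> j i \<odot> x1"
      "\<alpha> i j \<odot> p = \<beta> i j \<odot> x2" "\<alpha> j j \<odot> p' = \<beta> j j \<odot> x2"
      using sq ij by (auto simp: defs)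
    then have "pushout_square C p x1 (\<alpha> i i) (\<beta> i i)" "pushout_square C p x2 (\<alpha> i j) (\<beta> i j)"
      using refinement_pushout[OF X product_projectionI(1)[OF X12] x(1) col(1) product_projectionI(1)[OF row] \<alpha>(1)]
        refinement_pushout[OF X product_projectionI(2)[OF X12] x(2) col(2) product_projectionI(2)[OF row] \<alpha>(2)]
      by simp_all
    then show "\<exists>P1 y1 f1 P2 y2 f2. pushout_square C p x1 y1 f1 \<and> pushout_square C p x2 y2 f2 \<and>
        binary_product_diagram C A P1 y1 P2 y2"
      using row by blast
  qed
  then show ?thesis using coextensive_C1_imp_C2 Mor unfolding coextensive_def by blast
qed

section \<open>From coextensivity to strict refinement\<close>

text \<open>The splittings of the \<open>B j\<close> make \<open>X\<close> a product of
  \<open>P\<close> and \<open>P'\<close>. The induced \<open>\<gamma>\<close> and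
  \<open>\<gamma>'\<close> compare this with \<open>A\<close> and \<open>A'\<close>, so
  \<open>\<gamma>\<close> is invertible and carries the product structure of \<open>P\<close> over
  to \<open>A\<close>.\<close>

lemma product_diagram_of_splittings:
  assumes X: "binary_product_diagram C X A f A' f'" and b: "product_diagram C X J B b"
    and B: "\<And>j. j \<in> J \<Longrightarrow> binary_product_diagram C (B j) (E j) (\<beta> j) (E' j) (\<beta>' j)"
    and \<alpha>: "\<And>j. j \<in> J \<Longrightarrow> \<alpha> j \<in> Hom C A (E j) \<and> \<alpha> j \<odot> f = \<beta> j \<odot> b j"
    and \<alpha>': "\<And>j. j \<in> J \<Longrightarrow> \<alpha>' j \<in> Hom C A' (E' j) \<and> \<alpha>' j \<odot> f' = \<beta>' j \<odot> b j"
    and P: "product_diagram C P J E \<pi>" and P': "product_diagram C P' J E' \<pi>'"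
  shows "product_diagram C A J E \<alpha>"
proof -
  note f = binary_product_diagram_Hom[OF X]
  obtain \<gamma> where \<gamma>: "\<gamma> \<in> Hom C A P" "\<And>j. j \<in> J \<Longrightarrow> \<pi> j \<odot> \<gamma> = \<alpha> j"
    using product_diagram_pairing[OF P Hom_Ob(2)[OF f(1)], of \<alpha>] \<alpha> by blast
  obtain \<gamma>' where \<gamma>': "\<gamma>' \<in> Hom C A' P'" "\<And>j. j \<in> J \<Longrightarrow> \<pi>' j \<odot> \<gamma>' = \<alpha>' j"
    using product_diagram_pairing[OF P' Hom_Ob(2)[OF f(2)], of \<alpha>'] \<alpha>' by blast
  have d: "\<gamma> \<odot> f \<in> Hom C X P" and d': "\<gamma>' \<odot> f' \<in> Hom C X P'"
    using comp_closed[OF f(1) \<gamma>(1)] comp_closed[OF f(2) \<gamma>'(1)] .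
  have "binary_product_diagram C X P (\<gamma> \<odot> f) P' (\<gamma>' \<odot> f')"
  proof (rule binary_product_diagram_of_products[OF b B P P' d _ d'])
    show "\<pi> j \<odot> (\<gamma> \<odot> f) = \<beta> j \<odot> b j" if "j \<in> J" for j
      using comp_assoc[OF f(1) \<gamma>(1) product_diagram_Hom[OF P that]] \<gamma>(2) \<alpha> that by simp
    show "\<pi>' j \<odot> (\<gamma>' \<odot> f') = \<beta>' j \<odot> b j" if "j \<in> J" for j
      using comp_assoc[OF f(2) \<gamma>'(1) product_diagram_Hom[OF P' that]] \<gamma>'(2) \<alpha>' that by simp
  qed
  note Y = this
  obtain k where k: "k \<in> Hom C P A" "k \<odot> (\<gamma> \<odot> f) = f"
    using projection_comparison[OF X Y \<gamma>(1) refl \<gamma>'(1) refl] .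
  have "(k \<odot> \<gamma>) \<odot> f = Id C A \<odot> f"
    using comp_assoc[OF f(1) \<gamma>(1) k(1)] k(2) Id_comp[OF f(1)] by simp
  then have k\<gamma>: "k \<odot> \<gamma> = Id C A"
    using projection_epi[OF product_projectionI(1)[OF X] f(1) comp_closed[OF \<gamma>(1) k(1)]]
      Id_closed Hom_Ob(2)[OF f(1)] by blast
  \<comment> \<open>Being a leg of the diagram \<open>Y\<close>, \<open>\<gamma> \<odot> f\<close>
    is an epimorphism and can be cancelled.\<close>
  have "(\<gamma> \<odot> k) \<odot> (\<gamma> \<odot> f) = Id C P \<odot> (\<gamma> \<odot> f)"
    using comp_assoc[OF d k(1) \<gamma>(1)] k(2) Id_comp[OF d] by simp
  then have "\<gamma> \<odot> k = Id C P"
    using projection_epi[OF product_projectionI(1)[OF Y] d comp_closed[OF k(1) \<gamma>(1)]]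
      Id_closed Hom_Ob(2)[OF d] by blast
  then show ?thesis using product_diagram_iso[OF P \<gamma>(1) k(1) _ k\<gamma>] \<gamma>(2) by blast
qed

text \<open>(C1) for the legs \<open>b j\<close> produces the array \<open>E i j\<close>. Both rows
  and columns come from \<open>product_diagram_of_splittings\<close>; for the columns, the
  complement of \<open>E i j\<close> in \<open>A i\<close> is built from the other entries of row
  \<open>i\<close>.\<close>

lemma coextensive_imp_strict_refinement:
  fixes small :: "'i set \<Rightarrow> bool"
  assumes small: "smallness small" and products: "has_products small C"
    and coext: "\<And>p. product_projection C X p \<Longrightarrow> coextensive C p"
  shows "strict_refinement small C X"
  unfolding strict_refinement_def
proof (intro allI impI, elim conjE)
  fix I J :: "'i set" and A a B b
  assume I: "small I" and J: "small J"
    and a: "product_diagram C X I A a" and b: "product_diagram C X J B b"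
  note aH = product_diagram_Hom[OF a] and bH = product_diagram_Hom[OF b]
  have product: "\<exists>P p. product_diagram C P K F p" if "small K" "\<And>k. k \<in> K \<Longrightarrow> F k \<in> Ob C" for K F
    using products that unfolding has_products_def by blast
  have small_Diff: "small (K - {k})" if "small K" for K k
    using small that unfolding smallness_def by blast
  have "\<exists>P p. binary_product_diagram C X (A i) (a i) P p" if "i \<in> I" for i
    using product[OF small_Diff[OF I], of i A] product_diagram_split[OF a that] Hom_Ob(2)[OF aH]
    by (metis DiffD1)
  then obtain A' a' where A': "\<And>i. i \<in> I \<Longrightarrow> binary_product_diagram C X (A i) (a i) (A' i) (a' i)"
    by metis
  note a'H = binary_product_diagram_Hom(2)[OF A']
  \<comment> \<open>Here the projections \<open>q\<close> of the complement are kept, since the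
    morphisms \<open>\<delta>\<close> out of \<open>B' j\<close> are built from them.\<close>
  have "\<exists>P q p. product_diagram C P (J - {j}) B q \<and> binary_product_diagram C X (B j) (b j) P p \<and>
      (\<forall>k\<in>J - {j}. q k \<odot> p = b k)" if "j \<in> J" for j
  proof -
    obtain P q where P: "product_diagram C P (J - {j}) B q"
      using product[OF small_Diff[OF J], of j B] Hom_Ob(2)[OF bH] by blast
    then show ?thesis using product_diagram_split[OF b that P] by metis
  qed
  then obtain B' q b' where B'q: "\<And>j. j \<in> J \<Longrightarrow> product_diagram C (B' j) (J - {j}) B (q j)"
    and B': "\<And>j. j \<in> J \<Longrightarrow> binary_product_diagram C X (B j) (b j) (B' j) (b' j)"
    and q: "\<And>j k. j \<in> J \<Longrightarrow> k \<in> J - {j} \<Longrightarrow> q j k \<odot> b' j = b k"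
    by metis
  note b'H = binary_product_diagram_Hom(2)[OF B']
  have "\<exists>E \<beta> \<alpha> E' \<beta>' \<alpha>'. binary_product_diagram C (B j) E \<beta> E' \<beta>' \<and>
      \<alpha> \<in> Hom C (A i) E \<and> \<alpha> \<odot> a i = \<beta> \<odot> b j \<and> \<alpha>' \<in> Hom C (A' i) E' \<and> \<alpha>' \<odot> a' i = \<beta>' \<odot> b j"
    if i: "i \<in> I" and j: "j \<in> J" for i j
  proof -
    have Dom: "Dom C (b j) = X" and Cod: "Cod C (b j) = B j" using bH[OF j] by (auto simp: Hom_def)
    \<comment> \<open>Pushing \<open>b j\<close> out along \<open>a i\<close> and its complementary
      leg \<open>a' i\<close> splits \<open>B j\<close>.\<close>
    obtain E \<beta> \<alpha> E' \<beta>' \<alpha>' where po: "pushout_square C (b j) (a i) \<beta> \<alpha>"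
        "pushout_square C (b j) (a' i) \<beta>' \<alpha>'"
      and E: "binary_product_diagram C (B j) E \<beta> E' \<beta>'"
      using coext[OF product_projectionI(1)[OF B'[OF j]]] A'[OF i]
      unfolding coextensive_def coextensive_C1_def Dom Cod by metis
    have typing: "g \<in> Hom C F Q \<and> g \<odot> f = \<beta> \<odot> b j"
      if "pushout_square C (b j) f \<beta> g" "f \<in> Hom C X F" "\<beta> \<in> Hom C (B j) Q" for F Q f \<beta> g
      using that unfolding pushout_square_def Hom_def by auto
    show ?thesis
      using typing[OF po(1) aH[OF i]] typing[OF po(2) a'H[OF i]] E binary_product_diagram_Hom[OF E]
      by metis
  qed
  then obtain E \<beta> \<alpha> E' \<beta>' \<alpha>' where
      E: "\<And>i j. i \<in> I \<Longrightarrow> j \<in> J \<Longrightarrow> binary_product_diagram C (B j) (E i j) (\<beta> i j) (E' i j) (\<beta>' i j)"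
    and \<alpha>: "\<And>i j. i \<in> I \<Longrightarrow> j \<in> J \<Longrightarrow> \<alpha> i j \<in> Hom C (A i) (E i j) \<and> \<alpha> i j \<odot> a i = \<beta> i j \<odot> b j"
    and \<alpha>': "\<And>i j. i \<in> I \<Longrightarrow> j \<in> J \<Longrightarrow> \<alpha>' i j \<in> Hom C (A' i) (E' i j) \<and> \<alpha>' i j \<odot> a' i = \<beta>' i j \<odot> b j"
    by metis
  note \<beta> = binary_product_diagram_Hom(1)[OF E]
  have E_Ob: "E i j \<in> Ob C" "E' i j \<in> Ob C" if "i \<in> I" "j \<in> J" for i j
    using binary_product_diagram_Hom[OF E[OF that]] Hom_Ob(2) by blast+
  have rows: "product_diagram C (A i) J (E i) (\<alpha> i)" if i: "i \<in> I" for i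
  proof -
    obtain P \<pi> P' \<pi>' where "product_diagram C P J (E i) \<pi>" "product_diagram C P' J (E' i) \<pi>'"
      using product[OF J] E_Ob[OF i] by metis
    then show ?thesis
      using product_diagram_of_splittings[OF A'[OF i] b E[OF i] \<alpha>[OF i] \<alpha>'[OF i]] by blast
  qed
  have cols: "product_diagram C (B j) I (\<lambda>i. E i j) (\<lambda>i. \<beta> i j)" if j: "j \<in> J" for j
  proof -
    \<comment> \<open>The splitting of \<open>A i\<close> required with the roles of
      \<open>a\<close> and \<open>b\<close> exchanged: \<open>F\<close> is the product of the
      \<open>E i k\<close> with \<open>k \<noteq> j\<close>.\<close>
    have "\<exists>F \<epsilon> \<delta>. binary_product_diagram C (A i) (E i j) (\<alpha> i j) F \<epsilon> \<and>
        \<delta> \<in> Hom C (B' j) F \<and> \<delta> \<odot> b' j = \<epsilon> \<odot> a i" if i: "i \<in> I" for i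
    proof -
      obtain F r where F: "product_diagram C F (J - {j}) (E i) r"
        using product[OF small_Diff[OF J], of j "E i"] E_Ob(1)[OF i] by blast
      note r = product_diagram_Hom[OF F]
      obtain \<epsilon> where \<epsilon>: "binary_product_diagram C (A i) (E i j) (\<alpha> i j) F \<epsilon>"
          "\<And>k. k \<in> J - {j} \<Longrightarrow> r k \<odot> \<epsilon> = \<alpha> i k"
        using product_diagram_split[OF rows[OF i] j F] by blast
      note \<epsilon>H = binary_product_diagram_Hom(2)[OF \<epsilon>(1)]
      have qH: "q j k \<in> Hom C (B' j) (B k)" if "k \<in> J - {j}" for k
        using product_diagram_Hom[OF B'q[OF j] that] .
      have "\<beta> i k \<odot> q j k \<in> Hom C (B' j) (E i k)" if "k \<in> J - {j}" for k
        using comp_closed[OF qH[OF that] \<beta>] i that by blast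
      \<comment> \<open>Component \<open>k\<close> of \<open>\<delta>\<close> projects
        \<open>B' j\<close> to \<open>B k\<close> and continues by
        \<open>\<beta> i k\<close>.\<close>
      then obtain \<delta> where \<delta>: "\<delta> \<in> Hom C (B' j) F"
          "\<And>k. k \<in> J - {j} \<Longrightarrow> r k \<odot> \<delta> = \<beta> i k \<odot> q j k"
        using product_diagram_pairing[OF F Hom_Ob(2)[OF b'H[OF j]], of "\<lambda>k. \<beta> i k \<odot> q j k"] by blast
      have "\<delta> \<odot> b' j = \<epsilon> \<odot> a i"
      proof (rule product_diagram_eqI[OF F comp_closed[OF b'H[OF j] \<delta>(1)] comp_closed[OF aH[OF i] \<epsilon>H]])
        fix k assume k: "k \<in> J - {j}"
        have "r k \<odot> (\<delta> \<odot> b' j) = \<beta> i k \<odot> (q j k \<odot> b' j)"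
          using comp_square[OF \<delta>(2)[OF k] b'H[OF j] \<delta>(1) r[OF k] qH[OF k] \<beta>] i k by blast
        also have "\<dots> = \<alpha> i k \<odot> a i" using q[OF j k] \<alpha>[OF i] k by simp
        also have "\<dots> = r k \<odot> (\<epsilon> \<odot> a i)"
          using comp_assoc[OF aH[OF i] \<epsilon>H r[OF k]] \<epsilon>(2)[OF k] by simp
        finally show "r k \<odot> (\<delta> \<odot> b' j) = r k \<odot> (\<epsilon> \<odot> a i)" .
      qed
      then show ?thesis using \<epsilon>(1) \<delta>(1) by blast
    qed
    then obtain F \<epsilon> \<delta> where
        F: "\<And>i. i \<in> I \<Longrightarrow> binary_product_diagram C (A i) (E i j) (\<alpha> i j) (F i) (\<epsilon> i)"
      and \<delta>: "\<And>i. i \<in> I \<Longrightarrow> \<delta> i \<in> Hom C (B' j) (F i) \<and> \<delta> i \<odot> b' j = \<epsilon> i \<odot> a i"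
      by metis
    have "F i \<in> Ob C" if "i \<in> I" for i using \<delta>[OF that] Hom_Ob(2) by blast
    then obtain P \<pi> P' \<pi>' where "product_diagram C P I (\<lambda>i. E i j) \<pi>" "product_diagram C P' I F \<pi>'"
      using product[OF I] E_Ob(1)[OF _ j] by metis
    then show ?thesis
      using product_diagram_of_splittings[OF B'[OF j] a F _ \<delta>, of "\<lambda>i. \<beta> i j"] \<beta> \<alpha> j by simp
  qed
  show "\<exists>D \<alpha> \<beta>. (\<forall>i\<in>I. \<forall>j\<in>J. \<alpha> i j \<in> Hom C (A i) (D i j) \<and> \<beta> i j \<in> Hom C (B j) (D i j) \<and>
        \<alpha> i j \<odot> a i = \<beta> i j \<odot> b j) \<and>
      (\<forall>i\<in>I. product_diagram C (A i) J (D i) (\<alpha> i)) \<and>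
      (\<forall>j\<in>J. product_diagram C (B j) I (\<lambda>i. D i j) (\<lambda>i. \<beta> i j))"
    by (intro exI[of _ E] exI[of _ \<alpha>] exI[of _ \<beta>]) (use \<alpha> \<beta> rows cols in blast)
qed

end

section \<open>Combining the two directions\<close>

lemma regular_projectionsI:
  fixes small :: "'i set \<Rightarrow> bool"
  assumes "category C" and "smallness small" and "has_products small C"
    and "\<And>Y p. product_projection C Y p \<Longrightarrow> regular_epi C p"
  shows "regular_projections C"
proof -
  obtain i j :: 'i where ij: "i \<noteq> j" and small: "small {i, j}"
    using smallness_doubleton[OF assms(2)] .
  have "\<exists>P p p'. binary_product_diagram C P A p A' p'" if "A \<in> Ob C" "A' \<in> Ob C" for A A'
  proof -
    have "\<forall>k\<in>{i, j}. (if k = i then A else A') \<in> Ob C" using that by simp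
    then obtain P p where "product_diagram C P {i, j} (\<lambda>k. if k = i then A else A') p"
      using assms(3)[unfolded has_products_def, rule_format, of "{i, j}" "\<lambda>k. if k = i then A else A'"]
        small by blast
    then show ?thesis
      using ij unfolding product_diagram_doubleton_iff[OF ij] by auto
  qed
  then show ?thesis
    using assms(1,4) by (simp add: regular_projections_def regular_projections_axioms_def)
qed

text \<open>Stated for an arbitrary \<open>small\<close>, so that the finite and the unrestricted
  reading are both instances.\<close>

lemma strict_refinement_iff_coextensive:
  assumes "category C" and "smallness small" and "has_products small C"
    and "\<And>Y p. product_projection C Y p \<Longrightarrow> regular_epi C p"
  shows "strict_refinement small C X \<longleftrightarrow> (\<forall>p. product_projection C X p \<longrightarrow> coextensive C p)"
proof -
  interpret regular_projections C using regular_projectionsI[OF assms] .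
  show ?thesis
    using strict_refinement_imp_coextensive[OF assms(2)]
      coextensive_imp_strict_refinement[OF assms(2,3)] by blast
qed

theorem corollary2p32:
  fixes C :: "('o, 'm) cat" and X :: 'o
  assumes "category C"
    and "X \<in> Ob C"
    and "\<And>Y p. product_projection C Y p \<Longrightarrow> regular_epi C p"
  shows "(has_products (finite :: nat set \<Rightarrow> bool) C \<longrightarrow>
            (strict_refinement (finite :: nat set \<Rightarrow> bool) C X \<longleftrightarrow>
             (\<forall>p. product_projection C X p \<longrightarrow> coextensive C p))) \<and>
         (\<forall>small :: 'i set \<Rightarrow> bool. smallness small \<longrightarrow> has_products small C \<longrightarrow>
            (strict_refinement small C X \<longleftrightarrow>
             (\<forall>p. product_projection C X p \<longrightarrow> coextensive C p)))"
  by (intro conjI allI impI; rule strict_refinement_iff_coextensive)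
    (simp_all add: assms smallness_finite)

end
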